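(* Let $\bm{f}\in\mathbb{R}^{N}_+$, $\tau>0$ and $\theta\in[0,1]$, and let $\bm{A}=\bm{A_1}+\bm{A_2}$ be the discretised two-dimensional osmosis operator with its dimensional splitting as defined in the context. Let $(\bm{u}^k)_{k\ge0}$ be defined by $\bm{u}^0=\bm{f}$ and the Douglas scheme: for every $k\ge 0$, $$ \bm{y}^0=\bm{u}^k+\tau \bm{A}\bm{u}^k,\qquad \bm{y}^j =\bm{y}^{j-1}+\theta\tau(\bm{A_j} \bm{y}^j-\bm{A_j} \bm{u}^k)\quad (j=1,2),\qquad \bm{u}^{k+1}=\bm{y}^2 . $$ Then the scheme preserves the average gray value, i.e. $\frac1N\sum_{p=1}^N u^{k}_p=\frac1N\sum_{p=1}^N f_p$ for every $k\ge 0$.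
   Context: $\mathbb{R}^N_+$ denotes the set of vectors in $\mathbb{R}^N$ with strictly positive entries. Discretised osmosis operator. Let $m,n\ge 1$ be integers with $N:=mn\ge 2$, and let $h>0$ be the grid size. Vectors $\bm{u}\in\mathbb{R}^N$ are identified with grid functions $(u_{i,j})_{1\le i\le m,\,1\le j\le n}$. Let $d_{1,i+\frac12,j}$ ($0\le i\le m$, $1\le j\le n$) and $d_{2,i,j+\frac12}$ ($1\le i\le m$, $0\le j\le n$) be real numbers (values of the two components of a given drift vector field $\bm{d}$ at the cell interfaces). The linear operators $\bm{A_1},\bm{A_2}\in\mathbb{R}^{N\times N}$ are $$(\bm{A_1}\bm{u})_{i,j}=\frac{u_{i+1,j}-2u_{i,j}+u_{i-1,j}}{h^2}-\frac1h\Bigl(d_{1,i+\frac12,j}\frac{u_{i+1,j}+u_{i,j}}{2}-d_{1,i-\frac12,j}\frac{u_{i,j}+u_{i-1,j}}{2}\Bigr),$$ $$(\bm{A_2}\bm{u})_{i,j}=\frac{u_{i,j+1}-2u_{i,j}+u_{i,j-1}}{h^2}-\frac1h\Bigl(d_{2,i,j+\frac12}\frac{u_{i,j+1}+u_{i,j}}{2}-d_{2,i,j-\frac12}\frac{u_{i,j}+u_{i,j-1}}{2}\Bigr),$$ with the zero-flux boundary condition, the discrete form of $\langle\nabla u-\bm{d}u,\bm{n}\rangle=0$ on the boundary of the image domain: $u_{0,j}=u_{1,j}$, $u_{m+1,j}=u_{m,j}$, $u_{i,0}=u_{i,1}$, $u_{i,n+1}=u_{i,n}$ and $d_{1,\frac12,j}=d_{1,m+\frac12,j}=d_{2,i,\frac12}=d_{2,i,n+\frac12}=0$.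 Set $\bm{A}=\bm{A_1}+\bm{A_2}$. Standing assumption on the discretisation: $\bm{A}$ is irreducible and has non-negative off-diagonal entries (it has zero column sums by construction). *)

theory Defs
  imports "Jordan_Normal_Form.Matrix"
begin

text \<open>Vectors of dimension \<open>m * n\<close> are identified with grid functions on
  \<open>{1..m} \<times> {1..n}\<close>, the (zero-based) position of \<open>(i, j)\<close> being \<open>(i - 1) * n + (j - 1)\<close>.\<close>

definition grid_vec :: "nat \<Rightarrow> nat \<Rightarrow> (nat \<Rightarrow> nat \<Rightarrow> real) \<Rightarrow> real vec" where
  "grid_vec m n g = vec (m * n) (\<lambda>p. g (p div n + 1) (p mod n + 1))"

text \<open>Clamping the indices to \<open>{1..m}\<close> and \<open>{1..n}\<close> yields the ghost values
  \<open>u(0, j) = u(1, j)\<close>, \<open>u(m + 1, j) = u(m, j)\<close>, \<open>u(i, 0) = u(i, 1)\<close> and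
  \<open>u(i, n + 1) = u(i, n)\<close> of the zero-flux boundary condition.\<close>

definition vec_grid :: "nat \<Rightarrow> nat \<Rightarrow> real vec \<Rightarrow> nat \<Rightarrow> nat \<Rightarrow> real" where
  "vec_grid m n u i j = u $ ((max 1 (min i m) - 1) * n + (max 1 (min j n) - 1))"

text \<open>\<open>d1 i j\<close> and \<open>d2 i j\<close> are the drift values at the interfaces \<open>(i + 1/2, j)\<close> and
  \<open>(i, j + 1/2)\<close>, so \<open>d1 (i - 1) j\<close> is the one at \<open>(i - 1/2, j)\<close>. The two stencils are only
  used for \<open>i, j \<ge> 1\<close>, where the subtractions on naturals are exact.\<close>

definition osmosis_stencil1 ::
    "real \<Rightarrow> (nat \<Rightarrow> nat \<Rightarrow> real) \<Rightarrow> (nat \<Rightarrow> nat \<Rightarrow> real) \<Rightarrow> nat \<Rightarrow> nat \<Rightarrow> real" where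
  "osmosis_stencil1 h d1 u i j =
     (u (i + 1) j - 2 * u i j + u (i - 1) j) / h\<^sup>2
     - 1 / h * (d1 i j * ((u (i + 1) j + u i j) / 2)
                - d1 (i - 1) j * ((u i j + u (i - 1) j) / 2))"

definition osmosis_stencil2 ::
    "real \<Rightarrow> (nat \<Rightarrow> nat \<Rightarrow> real) \<Rightarrow> (nat \<Rightarrow> nat \<Rightarrow> real) \<Rightarrow> nat \<Rightarrow> nat \<Rightarrow> real" where
  "osmosis_stencil2 h d2 u i j =
     (u i (j + 1) - 2 * u i j + u i (j - 1)) / h\<^sup>2
     - 1 / h * (d2 i j * ((u i (j + 1) + u i j) / 2)
                - d2 i (j - 1) * ((u i j + u i (j - 1)) / 2))"

definition osmosis_op1 ::
    "nat \<Rightarrow> nat \<Rightarrow> real \<Rightarrow> (nat \<Rightarrow> nat \<Rightarrow> real) \<Rightarrow> real vec \<Rightarrow> real vec" where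
  "osmosis_op1 m n h d1 u = grid_vec m n (osmosis_stencil1 h d1 (vec_grid m n u))"

definition osmosis_op2 ::
    "nat \<Rightarrow> nat \<Rightarrow> real \<Rightarrow> (nat \<Rightarrow> nat \<Rightarrow> real) \<Rightarrow> real vec \<Rightarrow> real vec" where
  "osmosis_op2 m n h d2 u = grid_vec m n (osmosis_stencil2 h d2 (vec_grid m n u))"

definition matrix_of_op :: "nat \<Rightarrow> (real vec \<Rightarrow> real vec) \<Rightarrow> real mat" where
  "matrix_of_op N F = mat N N (\<lambda>(p, q). F (unit_vec N q) $ p)"

definition osmosis_mat1 :: "nat \<Rightarrow> nat \<Rightarrow> real \<Rightarrow> (nat \<Rightarrow> nat \<Rightarrow> real) \<Rightarrow> real mat" where
  "osmosis_mat1 m n h d1 = matrix_of_op (m * n) (osmosis_op1 m n h d1)"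

definition osmosis_mat2 :: "nat \<Rightarrow> nat \<Rightarrow> real \<Rightarrow> (nat \<Rightarrow> nat \<Rightarrow> real) \<Rightarrow> real mat" where
  "osmosis_mat2 m n h d2 = matrix_of_op (m * n) (osmosis_op2 m n h d2)"

definition osmosis_mat ::
    "nat \<Rightarrow> nat \<Rightarrow> real \<Rightarrow> (nat \<Rightarrow> nat \<Rightarrow> real) \<Rightarrow> (nat \<Rightarrow> nat \<Rightarrow> real) \<Rightarrow> real mat" where
  "osmosis_mat m n h d1 d2 = osmosis_mat1 m n h d1 + osmosis_mat2 m n h d2"

definition irreducible_mat :: "real mat \<Rightarrow> bool" where
  "irreducible_mat A \<longleftrightarrow>
     \<not> (\<exists>S. S \<noteq> {} \<and> S \<subset> {..<dim_row A} \<and> (\<forall>p\<in>S. \<forall>q\<in>{..<dim_row A} - S. A $$ (p, q) = 0))"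

definition nonneg_off_diagonal :: "real mat \<Rightarrow> bool" where
  "nonneg_off_diagonal A \<longleftrightarrow> (\<forall>p<dim_row A. \<forall>q<dim_col A. p \<noteq> q \<longrightarrow> 0 \<le> A $$ (p, q))"

text \<open>The stages are implicit for \<open>\<theta> > 0\<close>, hence the scheme is a relation between consecutive
  iterates.\<close>

definition douglas_step ::
    "nat \<Rightarrow> real mat \<Rightarrow> real mat \<Rightarrow> real \<Rightarrow> real \<Rightarrow> real vec \<Rightarrow> real vec \<Rightarrow> bool" where
  "douglas_step N A1 A2 \<tau> \<theta> v w \<longleftrightarrow>
     (\<exists>y0\<in>carrier_vec N. \<exists>y1\<in>carrier_vec N. \<exists>y2\<in>carrier_vec N.
        y0 = v + \<tau> \<cdot>\<^sub>v ((A1 + A2) *\<^sub>v v) \<and>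
        y1 = y0 + (\<theta> * \<tau>) \<cdot>\<^sub>v (A1 *\<^sub>v y1 - A1 *\<^sub>v v) \<and>
        y2 = y1 + (\<theta> * \<tau>) \<cdot>\<^sub>v (A2 *\<^sub>v y2 - A2 *\<^sub>v v) \<and>
        w = y2)"

text \<open>The matrices represent the stencil operators on all vectors of dimension \<open>m * n\<close>.\<close>

lemma vec_grid_index_less:
  assumes "1 \<le> m" "1 \<le> n"
  shows "(max 1 (min i m) - 1) * n + (max 1 (min j n) - 1) < m * (n::nat)"
proof -
  have a: "max 1 (min i m) - 1 + 1 \<le> m" and b: "max 1 (min j n) - 1 < n"
    using assms by auto
  have "(max 1 (min i m) - 1) * n + (max 1 (min j n) - 1) < (max 1 (min i m) - 1 + 1) * n"
    using b by (simp only: distrib_right mult_1 add_less_cancel_left)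
  also have "\<dots> \<le> m * n" using a by (rule mult_le_mono1)
  finally show ?thesis .
qed

lemma vec_grid_expand:
  assumes "1 \<le> m" "1 \<le> n" "u \<in> carrier_vec (m * n)"
  shows "vec_grid m n u i j = (\<Sum>q<m * n. vec_grid m n (unit_vec (m * n) q) i j * u $ q)"
proof -
  define x where "x = (max 1 (min i m) - 1) * n + (max 1 (min j n) - 1)"
  have x: "x < m * n" unfolding x_def using assms(1,2) by (rule vec_grid_index_less)
  have v: "vec_grid m n w i j = w $ x" for w
    by (simp only: vec_grid_def x_def)
  have "(\<Sum>q<m * n. vec_grid m n (unit_vec (m * n) q) i j * u $ q)
      = (\<Sum>q<m * n. if x = q then u $ q else 0)"
    by (rule sum.cong) (use x in \<open>auto simp: v\<close>)
  also have "\<dots> = u $ x" using x by simp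
  finally show ?thesis by (simp only: v)
qed

lemma osmosis_stencil1_linear:
  "osmosis_stencil1 h d (\<lambda>i j. a i j * r + b i j) i j
      = osmosis_stencil1 h d a i j * r + osmosis_stencil1 h d b i j"
proof -
  have "(x * r + x' - 2 * (y * r + y') + (z * r + z')) * k - l *
        (p * ((x * r + x' + (y * r + y')) * t) - q * ((y * r + y' + (z * r + z')) * t))
      = ((x - 2 * y + z) * k - l * (p * ((x + y) * t) - q * ((y + z) * t))) * r
        + ((x' - 2 * y' + z') * k - l * (p * ((x' + y') * t) - q * ((y' + z') * t)))"
    for x y z x' y' z' k l p q t :: real
    by (simp only: ring_distribs right_diff_distrib left_diff_distrib) (simp only: algebra_simps)
  then show ?thesis
    unfolding osmosis_stencil1_def divide_inverse by blast
qed

lemma osmosis_stencil1_sum: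
  assumes "finite Q"
  shows "osmosis_stencil1 h d (\<lambda>i j. \<Sum>q\<in>Q. g q i j * c q) i j
     = (\<Sum>q\<in>Q. osmosis_stencil1 h d (g q) i j * c q)"
  using assms
proof (induction Q rule: finite_induct)
  case empty
  show ?case by (simp add: osmosis_stencil1_def)
next
  case (insert x F)
  show ?case
    by (simp only: sum.insert[OF insert.hyps] osmosis_stencil1_linear insert.IH)
qed

lemma osmosis_stencil2_linear:
  "osmosis_stencil2 h d (\<lambda>i j. a i j * r + b i j) i j
      = osmosis_stencil2 h d a i j * r + osmosis_stencil2 h d b i j"
proof -
  have "(x * r + x' - 2 * (y * r + y') + (z * r + z')) * k - l *
        (p * ((x * r + x' + (y * r + y')) * t) - q * ((y * r + y' + (z * r + z')) * t))
      = ((x - 2 * y + z) * k - l * (p * ((x + y) * t) - q * ((y + z) * t))) * r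
        + ((x' - 2 * y' + z') * k - l * (p * ((x' + y') * t) - q * ((y' + z') * t)))"
    for x y z x' y' z' k l p q t :: real
    by (simp only: ring_distribs right_diff_distrib left_diff_distrib) (simp only: algebra_simps)
  then show ?thesis
    unfolding osmosis_stencil2_def divide_inverse by blast
qed

lemma osmosis_stencil2_sum:
  assumes "finite Q"
  shows "osmosis_stencil2 h d (\<lambda>i j. \<Sum>q\<in>Q. g q i j * c q) i j
     = (\<Sum>q\<in>Q. osmosis_stencil2 h d (g q) i j * c q)"
  using assms
proof (induction Q rule: finite_induct)
  case empty
  show ?case by (simp add: osmosis_stencil2_def)
next
  case (insert x F)
  show ?case
    by (simp only: sum.insert[OF insert.hyps] osmosis_stencil2_linear insert.IH)
qed

lemma osmosis_mat1_mult_vec: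
  assumes "1 \<le> m" "1 \<le> n" "u \<in> carrier_vec (m * n)"
  shows "osmosis_mat1 m n h d1 *\<^sub>v u = osmosis_op1 m n h d1 u"
proof -
  have e: "vec_grid m n u = (\<lambda>i j. \<Sum>q<m * n. vec_grid m n (unit_vec (m * n) q) i j * u $ q)"
    using vec_grid_expand[OF assms] by blast
  have s: "osmosis_stencil1 h d1 (vec_grid m n u) i j
      = (\<Sum>q<m * n. osmosis_stencil1 h d1 (vec_grid m n (unit_vec (m * n) q)) i j * u $ q)" for i j
    by (subst e) (rule osmosis_stencil1_sum[OF finite_lessThan])
  show ?thesis
    using assms(3)
    by (intro eq_vecI) (simp_all add: osmosis_mat1_def matrix_of_op_def osmosis_op1_def
        grid_vec_def scalar_prod_def s lessThan_atLeast0)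
qed

lemma osmosis_mat2_mult_vec:
  assumes "1 \<le> m" "1 \<le> n" "u \<in> carrier_vec (m * n)"
  shows "osmosis_mat2 m n h d2 *\<^sub>v u = osmosis_op2 m n h d2 u"
proof -
  have e: "vec_grid m n u = (\<lambda>i j. \<Sum>q<m * n. vec_grid m n (unit_vec (m * n) q) i j * u $ q)"
    using vec_grid_expand[OF assms] by blast
  have s: "osmosis_stencil2 h d2 (vec_grid m n u) i j
      = (\<Sum>q<m * n. osmosis_stencil2 h d2 (vec_grid m n (unit_vec (m * n) q)) i j * u $ q)" for i j
    by (subst e) (rule osmosis_stencil2_sum[OF finite_lessThan])
  show ?thesis
    using assms(3)
    by (intro eq_vecI) (simp_all add: osmosis_mat2_def matrix_of_op_def osmosis_op2_def
        grid_vec_def scalar_prod_def s lessThan_atLeast0)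
qed

end

theory Submission
  imports Defs
begin

text \<open>The two stencils are discrete divergences: each value is the difference of the numerical
  flux \<open>\<nabla>u - d u\<close> at two opposite cell interfaces. Summed along a grid line they telescope to the
  fluxes through the boundary, and these vanish: the clamped ghost values cancel the difference
  quotient there, and the boundary drift is zero. So \<open>osmosis_mat1\<close> and \<open>osmosis_mat2\<close> \<^emph>\<open>separately\<close>
  map every vector to one with entry sum zero (\<open>sum_osmosis_mat1_mult_vec\<close> and
  \<open>sum_osmosis_mat2_mult_vec\<close>). Every stage of the Douglas scheme adds to the previous one a
  combination of images of these two matrices, so no stage changes the entry sum
  (\<open>douglas_step_sum\<close>).\<close>

lemma sum_div_mod_grid:
  "(\<Sum>p<m * n. f (p div n) (p mod n)) = (\<Sum>i<m. \<Sum>j<n. f i j)"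
  for f :: "nat \<Rightarrow> nat \<Rightarrow> 'a::comm_monoid_add"
proof -
  have "(\<Sum>p = i * n..<i * n + n. f (p div n) (p mod n)) = (\<Sum>j<n. f i j)" for i
    using sum.shift_bounds_nat_ivl[of "\<lambda>p. f (p div n) (p mod n)" 0 "i * n" n]
    by (simp add: add.commute lessThan_atLeast0)
  then show ?thesis
    by (simp add: sum.nat_group[symmetric])
qed

lemma sum_grid_vec:
  "(\<Sum>p<m * n. grid_vec m n g $ p) = (\<Sum>i<m. \<Sum>j<n. g (Suc i) (Suc j))"
  using sum_div_mod_grid[of "\<lambda>i j. g (Suc i) (Suc j)" n m]
  by (simp add: grid_vec_def)

text \<open>The expression \<open>F i = (v (i + 1) - v i) / h\<^sup>2 - d i (v (i + 1) + v i) / (2 h)\<close> is the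
  numerical flux through the interface \<open>i + 1/2\<close>; the stencil is \<open>F i - F (i - 1)\<close>, and the
  hypotheses force \<open>F 0 = F m = 0\<close>.\<close>

lemma zero_flux_line_sum:
  fixes v d :: "nat \<Rightarrow> real"
  assumes "v 0 = v 1" "v (Suc m) = v m" "d 0 = 0" "d m = 0"
  shows "(\<Sum>i<m. (v (Suc (Suc i)) - 2 * v (Suc i) + v i) / h\<^sup>2
            - 1 / h * (d (Suc i) * ((v (Suc (Suc i)) + v (Suc i)) / 2)
                       - d i * ((v (Suc i) + v i) / 2))) = 0"
proof -
  define F where "F i = (v (Suc i) - v i) / h\<^sup>2 - 1 / h * (d i * ((v (Suc i) + v i) / 2))" for i
  have "(v (Suc (Suc i)) - 2 * v (Suc i) + v i) / h\<^sup>2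
            - 1 / h * (d (Suc i) * ((v (Suc (Suc i)) + v (Suc i)) / 2)
                       - d i * ((v (Suc i) + v i) / 2)) = F (Suc i) - F i" for i
    by (simp add: F_def diff_divide_distrib add_divide_distrib right_diff_distrib)
  moreover have "F m = 0" "F 0 = 0"
    using assms by (simp_all add: F_def)
  ultimately show ?thesis
    by (simp add: sum_lessThan_telescope)
qed

lemma sum_osmosis_mat1_mult_vec:
  assumes "1 \<le> m" "1 \<le> n" "v \<in> carrier_vec (m * n)"
    and d: "\<forall>j\<in>{1..n}. d1 0 j = 0 \<and> d1 m j = 0"
  shows "(\<Sum>p<m * n. (osmosis_mat1 m n h d1 *\<^sub>v v) $ p) = 0"
proof -
  have "(\<Sum>i<m. osmosis_stencil1 h d1 (vec_grid m n v) (Suc i) (Suc j)) = 0" if "j < n" for j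
  proof -
    have "vec_grid m n v 0 (Suc j) = vec_grid m n v 1 (Suc j)"
      "vec_grid m n v (Suc m) (Suc j) = vec_grid m n v m (Suc j)"
      using assms(1) by (simp_all add: vec_grid_def)
    moreover have "d1 0 (Suc j) = 0" "d1 m (Suc j) = 0"
      using d that by auto
    ultimately show ?thesis
      unfolding osmosis_stencil1_def
      using zero_flux_line_sum[of "\<lambda>i. vec_grid m n v i (Suc j)" m "\<lambda>i. d1 i (Suc j)" h]
      by simp
  qed
  then have "(\<Sum>j<n. \<Sum>i<m. osmosis_stencil1 h d1 (vec_grid m n v) (Suc i) (Suc j)) = 0"
    by simp
  \<comment> \<open>The flux runs in the direction of the outer index, hence the exchange of the two sums.\<close>
  then show ?thesis
    by (subst (asm) sum.swap)
      (simp add: osmosis_mat1_mult_vec[OF assms(1-3)] osmosis_op1_def sum_grid_vec)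
qed

lemma sum_osmosis_mat2_mult_vec:
  assumes "1 \<le> m" "1 \<le> n" "v \<in> carrier_vec (m * n)"
    and d: "\<forall>i\<in>{1..m}. d2 i 0 = 0 \<and> d2 i n = 0"
  shows "(\<Sum>p<m * n. (osmosis_mat2 m n h d2 *\<^sub>v v) $ p) = 0"
proof -
  have "(\<Sum>j<n. osmosis_stencil2 h d2 (vec_grid m n v) (Suc i) (Suc j)) = 0" if "i < m" for i
  proof -
    have "vec_grid m n v (Suc i) 0 = vec_grid m n v (Suc i) 1"
      "vec_grid m n v (Suc i) (Suc n) = vec_grid m n v (Suc i) n"
      using assms(2) by (simp_all add: vec_grid_def)
    moreover have "d2 (Suc i) 0 = 0" "d2 (Suc i) n = 0"
      using d that by auto
    ultimately show ?thesis
      unfolding osmosis_stencil2_def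
      using zero_flux_line_sum[of "vec_grid m n v (Suc i)" n "d2 (Suc i)" h]
      by simp
  qed
  then show ?thesis
    by (simp add: osmosis_mat2_mult_vec[OF assms(1-3)] osmosis_op2_def sum_grid_vec)
qed

text \<open>The conservation property belongs to the splitting scheme itself: it holds for any two
  matrices with zero column sums, here expressed through their action on vectors.\<close>

lemma douglas_step_sum:
  assumes A1: "A1 \<in> carrier_mat N N" "\<And>x. x \<in> carrier_vec N \<Longrightarrow> (\<Sum>p<N. (A1 *\<^sub>v x) $ p) = 0"
    and A2: "A2 \<in> carrier_mat N N" "\<And>x. x \<in> carrier_vec N \<Longrightarrow> (\<Sum>p<N. (A2 *\<^sub>v x) $ p) = 0"
    and v: "v \<in> carrier_vec N"
    and step: "douglas_step N A1 A2 \<tau> \<theta> v w"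
  shows "(\<Sum>p<N. w $ p) = (\<Sum>p<N. v $ p)"
proof -
  obtain y0 y1 where y: "y0 \<in> carrier_vec N" "y1 \<in> carrier_vec N" "w \<in> carrier_vec N"
    and y0: "y0 = v + \<tau> \<cdot>\<^sub>v ((A1 + A2) *\<^sub>v v)"
    and y1: "y1 = y0 + (\<theta> * \<tau>) \<cdot>\<^sub>v (A1 *\<^sub>v y1 - A1 *\<^sub>v v)"
    and w: "w = y1 + (\<theta> * \<tau>) \<cdot>\<^sub>v (A2 *\<^sub>v w - A2 *\<^sub>v v)"
    using step unfolding douglas_step_def by blast
  \<comment> \<open>The implicit stage equations hold entrywise; \<open>y1\<close> and \<open>w\<close> occur on both sides, so they
      cannot serve as rewrite rules for the vectors.\<close>
  have e0: "y0 $ p = v $ p + \<tau> * ((A1 *\<^sub>v v) $ p + (A2 *\<^sub>v v) $ p)" if "p < N" for p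
    using that A1(1) A2(1) v by (simp add: y0 add_mult_distrib_mat_vec[OF A1(1) A2(1) v])
  have e1: "y1 $ p = y0 $ p + (\<theta> * \<tau>) * ((A1 *\<^sub>v y1) $ p - (A1 *\<^sub>v v) $ p)" if "p < N" for p
    using arg_cong[OF y1, of "\<lambda>x. x $ p"] that A1(1) y by simp
  have e2: "w $ p = y1 $ p + (\<theta> * \<tau>) * ((A2 *\<^sub>v w) $ p - (A2 *\<^sub>v v) $ p)" if "p < N" for p
    using arg_cong[OF w, of "\<lambda>x. x $ p"] that A2(1) y by simp
  have "(\<Sum>p<N. w $ p)
      = (\<Sum>p<N. y1 $ p) + (\<theta> * \<tau>) * ((\<Sum>p<N. (A2 *\<^sub>v w) $ p) - (\<Sum>p<N. (A2 *\<^sub>v v) $ p))"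
    using sum.cong[OF refl e2, of "{..<N}"]
    by (simp only: lessThan_iff sum.distrib sum_subtractf flip: sum_distrib_left)
  moreover have "(\<Sum>p<N. y1 $ p)
      = (\<Sum>p<N. y0 $ p) + (\<theta> * \<tau>) * ((\<Sum>p<N. (A1 *\<^sub>v y1) $ p) - (\<Sum>p<N. (A1 *\<^sub>v v) $ p))"
    using sum.cong[OF refl e1, of "{..<N}"]
    by (simp only: lessThan_iff sum.distrib sum_subtractf flip: sum_distrib_left)
  moreover have "(\<Sum>p<N. y0 $ p)
      = (\<Sum>p<N. v $ p) + \<tau> * ((\<Sum>p<N. (A1 *\<^sub>v v) $ p) + (\<Sum>p<N. (A2 *\<^sub>v v) $ p))"
    using sum.cong[OF refl e0, of "{..<N}"]
    by (simp only: lessThan_iff sum.distrib flip: sum_distrib_left)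
  ultimately show ?thesis
    using A1(2) A2(2) y v by simp
qed

theorem proposition2:
  fixes m n :: nat and h \<tau> \<theta> :: real
    and d1 d2 :: "nat \<Rightarrow> nat \<Rightarrow> real"
    and f :: "real vec" and u :: "nat \<Rightarrow> real vec"
  assumes "1 \<le> m" and "1 \<le> n" and "2 \<le> m * n" and "0 < h"
    and "\<forall>j\<in>{1..n}. d1 0 j = 0 \<and> d1 m j = 0"
    and "\<forall>i\<in>{1..m}. d2 i 0 = 0 \<and> d2 i n = 0"
    and "irreducible_mat (osmosis_mat m n h d1 d2)"
    and "nonneg_off_diagonal (osmosis_mat m n h d1 d2)"
    and "f \<in> carrier_vec (m * n)" and "\<forall>p<m * n. 0 < f $ p"
    and "0 < \<tau>" and "0 \<le> \<theta>" and "\<theta> \<le> 1"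
    and "u 0 = f"
    and "\<forall>k. douglas_step (m * n) (osmosis_mat1 m n h d1) (osmosis_mat2 m n h d2) \<tau> \<theta>
           (u k) (u (Suc k))"
  shows "\<forall>k. 1 / real (m * n) * (\<Sum>p<m * n. u k $ p) = 1 / real (m * n) * (\<Sum>p<m * n. f $ p)"
proof
  fix k
  let ?A1 = "osmosis_mat1 m n h d1" and ?A2 = "osmosis_mat2 m n h d2"
  have A: "?A1 \<in> carrier_mat (m * n) (m * n)" "?A2 \<in> carrier_mat (m * n) (m * n)"
    by (simp_all add: osmosis_mat1_def osmosis_mat2_def matrix_of_op_def)
  have step: "douglas_step (m * n) ?A1 ?A2 \<tau> \<theta> (u k) (u (Suc k))" for k
    using assms(15) by blast
  have "u k \<in> carrier_vec (m * n) \<and> (\<Sum>p<m * n. u k $ p) = (\<Sum>p<m * n. f $ p)"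
  proof (induction k)
    case 0
    show ?case using assms(9,14) by simp
  next
    case (Suc k)
    have "u (Suc k) \<in> carrier_vec (m * n)"
      using step[of k] unfolding douglas_step_def by blast
    moreover have "(\<Sum>p<m * n. u (Suc k) $ p) = (\<Sum>p<m * n. u k $ p)"
      using Suc sum_osmosis_mat1_mult_vec[OF assms(1,2) _ assms(5)]
        sum_osmosis_mat2_mult_vec[OF assms(1,2) _ assms(6)]
      by (intro douglas_step_sum[OF A(1) _ A(2) _ _ step]) auto
    ultimately show ?case using Suc by simp
  qed
  then show "1 / real (m * n) * (\<Sum>p<m * n. u k $ p) = 1 / real (m * n) * (\<Sum>p<m * n. f $ p)"
    by simp
qed

end
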